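(* Let $0<\epsilon<1$, let $K$ be a positive integer and $c>0$, and suppose $\log(1/\epsilon)\le (2K-2)\log(c)$. Then the game $\mathrm{DIR}(K,c)$ has an $\epsilon$-correlated equilibrium $\pi$ which plays the action profile $(K,K)$ (the unique correlated equilibrium of the game) with probability $0$. Moreover, the welfare of this $\pi$ is at most a fraction $\frac{1+\lceil \log(1/\epsilon)/\log(c)\rceil}{2K}$ of the equilibrium welfare, i.e. of the welfare $u_1(K,K)+u_2(K,K)$ of the profile $(K,K)$.
   Context: The Diamond-In-the-Rough game $\mathrm{DIR}(K,c)$, with $K$ a positive integer and $c>0$, is the two-player game in which both players have action set $[K]=\{1,\dots,K\}$ and, with $\rho=\max\{K,c\}$, the payoffs when player 1 plays $i$ and player 2 plays $j$ are $u_1(i,j)=i/\rho$ if $i\le j+1$ and $u_1(i,j)=-c/\rho$ if $i>j+1$; $u_2(i,j)=j/\rho$ if $j\le i$ and $u_2(i,j)=-c/\rho$ if $j>i$. A probability distribution $\pi$ over action profiles is an $\epsilon$-correlated equilibrium ($\epsilon$-CE) if for every player $n$ and any two actions $a_n,a_n'$ of player $n$, $\sum_{a_{-n}}\pi(a_n,a_{-n})\,[u_n(a_n',a_{-n})-u_n(a_n,a_{-n})]\le\epsilon$; for $\epsilon=0$ this is a correlated equilibrium. The welfare of $\pi$ is the expected sum of the two players' payoffs under $\pi$. *)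

theory Defs
  imports "HOL-Probability.Probability_Mass_Function"
begin

record ('a, 'b) two_player_game =
  actions1 :: "'a set"
  actions2 :: "'b set"
  payoff1 :: "'a \<Rightarrow> 'b \<Rightarrow> real"
  payoff2 :: "'a \<Rightarrow> 'b \<Rightarrow> real"

text \<open>
  The deviation gains below are weighted with the joint probabilities, not with the conditional
  ones. The sums are meaningful for finite action sets.
\<close>

definition eps_correlated_eq ::
  "('a, 'b) two_player_game \<Rightarrow> real \<Rightarrow> ('a \<times> 'b) pmf \<Rightarrow> bool" where
  "eps_correlated_eq G \<epsilon> \<pi> \<longleftrightarrow>
     set_pmf \<pi> \<subseteq> actions1 G \<times> actions2 G \<and>
     (\<forall>a\<in>actions1 G. \<forall>a'\<in>actions1 G.
        (\<Sum>b\<in>actions2 G. pmf \<pi> (a, b) * (payoff1 G a' b - payoff1 G a b)) \<le> \<epsilon>) \<and>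
     (\<forall>b\<in>actions2 G. \<forall>b'\<in>actions2 G.
        (\<Sum>a\<in>actions1 G. pmf \<pi> (a, b) * (payoff2 G a b' - payoff2 G a b)) \<le> \<epsilon>)"

definition correlated_eq :: "('a, 'b) two_player_game \<Rightarrow> ('a \<times> 'b) pmf \<Rightarrow> bool" where
  "correlated_eq G \<pi> \<longleftrightarrow> eps_correlated_eq G 0 \<pi>"

definition welfare :: "('a, 'b) two_player_game \<Rightarrow> ('a \<times> 'b) pmf \<Rightarrow> real" where
  "welfare G \<pi> = measure_pmf.expectation \<pi> (\<lambda>(a, b). payoff1 G a b + payoff2 G a b)"

definition DIR :: "nat \<Rightarrow> real \<Rightarrow> (nat, nat) two_player_game" where
  "DIR K c =
     \<lparr> actions1 = {1..K},
       actions2 = {1..K},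
       payoff1 = (\<lambda>i j. if i \<le> j + 1 then real i / max (real K) c else - c / max (real K) c),
       payoff2 = (\<lambda>i j. if j \<le> i then real j / max (real K) c else - c / max (real K) c) \<rparr>"

end

theory Submission
  imports Defs
begin

text \<open>
  Actions below the top one are eliminated by iterated strict dominance, in the order
  of player 1's action 1, player 2's action 1, player 1's action 2, and so on; this leaves only
  the profile \<open>(K, K)\<close>. For the approximate equilibrium, follow the best-response path
  \<open>(1,1), (2,1), (2,2), (3,2), \<dots>\<close> and give its \<open>t\<close>-th profile a probability proportional to
  \<open>c ^ t\<close>, for \<open>t \<le> L = \<lceil>log (1/\<epsilon>) / log c\<rceil>\<close>. A player who is told an action is at one of two
  consecutive profiles of the path, and the one profitable deviation gains \<open>1/\<rho>\<close> at the later
  one and loses more than \<open>c/\<rho>\<close> at the earlier one, which is \<open>c\<close> times less likely. The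
  exception is the first profile, which has no predecessor, but its probability is at most
  \<open>c ^ (1 - L) \<le> \<epsilon> c\<close>.
\<close>

lemma actions_DIR:
  shows "actions1 (DIR K c) = {1..K}" and "actions2 (DIR K c) = {1..K}"
  by (simp_all add: DIR_def)

text \<open>If both players use only actions at least \<open>k\<close>, then \<open>k + 1\<close> is
  safe for player 1 and beats \<open>k\<close> by \<open>1 / max K c\<close> everywhere, so row
  \<open>k\<close> has no mass. Only then is \<open>k + 1\<close> safe for player 2 as well, which
  empties column \<open>k\<close>.\<close>

lemma correlated_eq_DIR_support_ge:
  assumes ce: "correlated_eq (DIR K c) \<sigma>" and K: "1 \<le> K"
    and k: "1 \<le> k" "k \<le> K"
  shows "set_pmf \<sigma> \<subseteq> {k..K} \<times> {k..K}"
  using k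
proof (induction k rule: dec_induct)
  case base
  then show ?case
    using ce by (simp add: correlated_eq_def eps_correlated_eq_def actions_DIR)
next
  case (step k)
  have rho: "max (real K) c > 0" using K by linarith
  have kK: "k \<in> {1..K}" "k + 1 \<in> {1..K}" using step by auto
  have IH: "set_pmf \<sigma> \<subseteq> {k..K} \<times> {k..K}" using step by simp
  have ce1: "(\<Sum>b\<in>{1..K}. pmf \<sigma> (k, b) *
      (payoff1 (DIR K c) (k + 1) b - payoff1 (DIR K c) k b)) \<le> 0"
    and ce2: "(\<Sum>a\<in>{1..K}. pmf \<sigma> (a, k) *
      (payoff2 (DIR K c) a (k + 1) - payoff2 (DIR K c) a k)) \<le> 0"
    using ce kK unfolding correlated_eq_def eps_correlated_eq_def actions_DIR by blast+
  have outside: "pmf \<sigma> (a, b) = 0" if "a < k \<or> b < k" for a b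
    using IH that by (force simp: set_pmf_iff)
  have "(\<Sum>b\<in>{1..K}. pmf \<sigma> (k, b) *
      (payoff1 (DIR K c) (k + 1) b - payoff1 (DIR K c) k b)) =
      (\<Sum>b\<in>{1..K}. pmf \<sigma> (k, b) * (1 / max (real K) c))"
  proof (rule sum.cong)
    fix b
    show "pmf \<sigma> (k, b) * (payoff1 (DIR K c) (k + 1) b - payoff1 (DIR K c) k b) =
        pmf \<sigma> (k, b) * (1 / max (real K) c)"
      by (cases "b < k") (simp_all add: outside DIR_def flip: diff_divide_distrib)
  qed simp
  with ce1 have "(\<Sum>b\<in>{1..K}. pmf \<sigma> (k, b)) / max (real K) c \<le> 0"
    by (simp add: sum_divide_distrib)
  then have "(\<Sum>b\<in>{1..K}. pmf \<sigma> (k, b)) \<le> 0"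
    by (simp only: pos_divide_le_eq[OF rho] mult_zero_left)
  then have "(\<Sum>b\<in>{1..K}. pmf \<sigma> (k, b)) = 0"
    by (simp add: sum_nonneg antisym)
  then have row: "pmf \<sigma> (k, b) = 0" if "b \<in> {1..K}" for b
    using that by (subst (asm) sum_nonneg_eq_0_iff) auto
  \<comment> \<open>With row \<open>k\<close> empty, column \<open>k\<close> carries mass only where
    \<open>a > k\<close>, and there \<open>k + 1\<close> still earns player 2 its positive
    payoff.\<close>
  have outside': "pmf \<sigma> (a, k) = 0" if "a \<le> k" for a
    using that outside[of a k] row[of k] kK by (cases "a = k") auto
  have "(\<Sum>a\<in>{1..K}. pmf \<sigma> (a, k) *
      (payoff2 (DIR K c) a (k + 1) - payoff2 (DIR K c) a k)) =
      (\<Sum>a\<in>{1..K}. pmf \<sigma> (a, k) * (1 / max (real K) c))"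
  proof (rule sum.cong)
    fix a
    show "pmf \<sigma> (a, k) * (payoff2 (DIR K c) a (k + 1) - payoff2 (DIR K c) a k) =
        pmf \<sigma> (a, k) * (1 / max (real K) c)"
      by (cases "a \<le> k") (simp_all add: outside' DIR_def flip: diff_divide_distrib)
  qed simp
  with ce2 have "(\<Sum>a\<in>{1..K}. pmf \<sigma> (a, k)) / max (real K) c \<le> 0"
    by (simp add: sum_divide_distrib)
  then have "(\<Sum>a\<in>{1..K}. pmf \<sigma> (a, k)) \<le> 0"
    by (simp only: pos_divide_le_eq[OF rho] mult_zero_left)
  then have "(\<Sum>a\<in>{1..K}. pmf \<sigma> (a, k)) = 0"
    by (simp add: sum_nonneg antisym)
  then have col: "pmf \<sigma> (a, k) = 0" if "a \<in> {1..K}" for a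
    using that by (subst (asm) sum_nonneg_eq_0_iff) auto
  show ?case
  proof
    fix x assume x: "x \<in> set_pmf \<sigma>"
    obtain a b where ab: "x = (a, b)" by (cases x)
    have "a \<in> {k..K}" "b \<in> {k..K}" using IH x ab by auto
    moreover have "pmf \<sigma> (a, b) \<noteq> 0" using x ab by (simp add: set_pmf_iff)
    ultimately show "x \<in> {Suc k..K} \<times> {Suc k..K}"
      using row[of b] col[of a] ab step(1) by (cases "a = k"; cases "b = k") auto
  qed
qed

lemma correlated_eq_DIR_iff:
  assumes K: "1 \<le> K" and c: "0 < c"
  shows "correlated_eq (DIR K c) \<sigma> \<longleftrightarrow> \<sigma> = return_pmf (K, K)"
proof
  assume "correlated_eq (DIR K c) \<sigma>"
  from correlated_eq_DIR_support_ge[OF this K K order.refl]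
  have "set_pmf \<sigma> \<subseteq> {(K, K)}" by auto
  then show "\<sigma> = return_pmf (K, K)"
    by (simp add: set_pmf_subset_singleton)
next
  assume \<sigma>: "\<sigma> = return_pmf (K, K)"
  have rho: "max (real K) c > 0" using c by linarith
  have "- c / max (real K) c \<le> real K / max (real K) c"
    using c rho by (intro divide_right_mono) auto
  then show "correlated_eq (DIR K c) \<sigma>"
    unfolding correlated_eq_def eps_correlated_eq_def actions_DIR \<sigma>
    using K rho
    by (intro conjI ballI sum_nonpos)
      (auto simp: DIR_def indicator_def intro!: divide_right_mono)
qed

text \<open>The coordinates at index \<open>t\<close> sum to \<open>t + 1\<close>. The path proper
  starts with \<open>(1, 1)\<close> at index 1 and reaches \<open>(K, K)\<close> at index
  \<open>2 * K - 1\<close>; index 0 gives \<open>(1, 0)\<close>, which is no action profile but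
  keeps the parity formulas uniform.\<close>

definition best_response_path :: "nat \<Rightarrow> nat \<times> nat" where
  "best_response_path t = (t div 2 + 1, (t + 1) div 2)"

lemma inj_best_response_path: "inj best_response_path"
proof (rule inj_on_inverseI[where g = "\<lambda>(a, b). a + b - 1"])
  show "(\<lambda>(a, b). a + b - 1) (best_response_path t) = t" for t
    unfolding best_response_path_def by simp presburger
qed

lemma best_response_path_even: "best_response_path (2 * n) = (n + 1, n)"
  and best_response_path_odd: "best_response_path (2 * n + 1) = (n + 1, n + 1)"
  by (auto simp: best_response_path_def)

lemma pmf_best_response_path:
  shows "pmf (map_pmf best_response_path q) (n + 1, n) = pmf q (2 * n)"
    and "pmf (map_pmf best_response_path q) (n + 1, n + 1) = pmf q (2 * n + 1)"
  using pmf_map_inj'[OF inj_best_response_path, of q "2 * n"]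
    pmf_map_inj'[OF inj_best_response_path, of q "2 * n + 1"]
  unfolding best_response_path_even best_response_path_odd .

lemma pmf_best_response_path_eq_0:
  assumes "a \<noteq> b" "a \<noteq> b + 1"
  shows "pmf (map_pmf best_response_path q) (a, b) = 0"
  using assms by (auto simp: pmf_eq_0_set_pmf best_response_path_def)

text \<open>Player 1 plays \<open>n + 1\<close> at indices \<open>2 * n\<close> and
  \<open>2 * n + 1\<close>, player 2 at \<open>2 * n + 1\<close> and \<open>2 * n + 2\<close>. Each
  incentive sum therefore has only two terms, at consecutive indices, and can be bounded through the
  law \<open>q\<close> of the index.\<close>

lemma eps_correlated_eq_DIR_best_response_path:
  assumes c: "0 < c" and \<epsilon>: "0 \<le> \<epsilon>"
    and supp: "set_pmf q \<subseteq> {1..2 * K - 2}"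
    and first: "pmf q 1 \<le> \<epsilon> * max (real K) c"
    and growth: "\<And>t. 1 \<le> t \<Longrightarrow> pmf q (t + 1) \<le> c * pmf q t"
  shows "eps_correlated_eq (DIR K c) \<epsilon> (map_pmf best_response_path q)"
    (is "eps_correlated_eq ?G \<epsilon> ?\<pi>")
proof -
  define \<rho> where "\<rho> = max (real K) c"
  have \<rho>: "\<rho> > 0" using c by (simp add: \<rho>_def)
  have c\<rho>: "- c / \<rho> \<le> real n / \<rho>" for n
    using c \<rho> by (intro divide_right_mono) auto
  have u1: "payoff1 ?G i j = (if i \<le> j + 1 then real i / \<rho> else - c / \<rho>)" for i j
    by (simp add: DIR_def \<rho>_def)
  have u2: "payoff2 ?G i j = (if j \<le> i then real j / \<rho> else - c / \<rho>)" for i j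
    by (simp add: DIR_def \<rho>_def)
  have q0: "pmf q 0 = 0" using supp by (force simp: pmf_eq_0_set_pmf)
  \<comment> \<open>The incentive to move from \<open>n\<close> to \<open>n + 1\<close>. For
    \<open>t = 0\<close> only the gain is left and \<open>first\<close> bounds it; otherwise
    \<open>growth\<close> makes the whole sum nonpositive.\<close>
  have gain: "pmf q t * (- c / \<rho> - real n / \<rho>) + pmf q (t + 1) * (1 / \<rho>) \<le> \<epsilon>" for t n
  proof (cases "t = 0")
    case True
    then show ?thesis using first \<rho> q0 by (simp add: \<rho>_def divide_le_eq)
  next
    case False
    then have "pmf q (t + 1) \<le> c * pmf q t" by (intro growth) auto
    also have "\<dots> \<le> (c + n) * pmf q t" by (intro mult_right_mono) auto
    finally have "(pmf q (t + 1) - (c + n) * pmf q t) / \<rho> \<le> 0"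
      using \<rho> by (simp add: divide_le_0_iff)
    then show ?thesis using \<epsilon> by (simp add: diff_divide_distrib add_divide_distrib algebra_simps)
  qed
  have loss: "pmf q s * x + pmf q t * y \<le> \<epsilon>" if "x \<le> 0" "y \<le> 0" for s t x y
    using \<epsilon> mult_nonneg_nonpos[OF pmf_nonneg that(1), of q s]
      mult_nonneg_nonpos[OF pmf_nonneg that(2), of q t] by linarith
  have supp\<pi>: "set_pmf ?\<pi> \<subseteq> {1..K} \<times> {1..K}"
    using supp by (fastforce simp: best_response_path_def)
  have dev1: "(\<Sum>b\<in>{1..K}. pmf ?\<pi> (a, b) * (payoff1 ?G a' b - payoff1 ?G a b)) \<le> \<epsilon>"
    if a: "a \<in> {1..K}" for a a'
  proof -
    obtain n where n: "a = n + 1" using a by (cases a) auto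
    let ?g = "\<lambda>b. payoff1 ?G a' b - payoff1 ?G a b"
    have "(\<Sum>b\<in>{1..K}. pmf ?\<pi> (a, b) * ?g b) = (\<Sum>b\<in>{n, n + 1}. pmf ?\<pi> (a, b) * ?g b)"
    proof (rule sum.mono_neutral_cong)
      \<comment> \<open>This happens only for \<open>n = 0\<close>, at path index 0, where
        \<open>q\<close> vanishes.\<close>
      fix b assume "b \<in> {n, n + 1} - {1..K}"
      then have "b = 0" "b = n" using a n by auto
      then show "pmf ?\<pi> (a, b) * ?g b = 0"
        using pmf_best_response_path(1)[of q 0] q0 n by simp
    next
      fix b assume "b \<in> {1..K} - {n, n + 1}"
      then show "pmf ?\<pi> (a, b) * ?g b = 0"
        using pmf_best_response_path_eq_0[of a b q] n by auto
    qed auto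
    also have "\<dots> = pmf q (2 * n) * ?g n + pmf q (2 * n + 1) * ?g (n + 1)"
      unfolding n using pmf_best_response_path[of q n] by simp
    also have "\<dots> \<le> \<epsilon>"
    proof (cases "a' = n + 2")
      case True
      then show ?thesis
        using gain[of "2 * n" "n + 1"] n by (simp add: u1 flip: diff_divide_distrib)
    next
      \<comment> \<open>A deviation to at most \<open>n + 1\<close> never pays more, and one above
        \<open>n + 2\<close> is punished against both \<open>n\<close> and
        \<open>n + 1\<close>.\<close>
      case False
      then have "?g n \<le> 0" "?g (n + 1) \<le> 0"
        using \<rho> c\<rho>[of a] n by (auto simp: u1 divide_right_mono)
      then show ?thesis by (rule loss)
    qed
    finally show ?thesis .
  qed
  have dev2: "(\<Sum>a\<in>{1..K}. pmf ?\<pi> (a, b) * (payoff2 ?G a b' - payoff2 ?G a b)) \<le> \<epsilon>"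
    if b: "b \<in> {1..K}" for b b'
  proof -
    obtain n where n: "b = n + 1" using b by (cases b) auto
    let ?g = "\<lambda>a. payoff2 ?G a b' - payoff2 ?G a b"
    have "(\<Sum>a\<in>{1..K}. pmf ?\<pi> (a, b) * ?g a) = (\<Sum>a\<in>{b, b + 1}. pmf ?\<pi> (a, b) * ?g a)"
    proof (rule sum.mono_neutral_cong)
      \<comment> \<open>Only \<open>a = K + 1\<close> is possible here, beyond the support.\<close>
      fix a assume "a \<in> {b, b + 1} - {1..K}"
      then have "(a, b) \<notin> set_pmf ?\<pi>" using supp\<pi> by auto
      then have "pmf ?\<pi> (a, b) = 0" by (rule pmf_eq_0_set_pmf[THEN iffD2])
      then show "pmf ?\<pi> (a, b) * ?g a = 0" by simp
    next
      fix a assume "a \<in> {1..K} - {b, b + 1}"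
      then show "pmf ?\<pi> (a, b) * ?g a = 0"
        using pmf_best_response_path_eq_0[of a b q] by auto
    qed auto
    also have "\<dots> = pmf q (2 * n + 1) * ?g b + pmf q (2 * n + 1 + 1) * ?g (b + 1)"
      unfolding n using pmf_best_response_path(2)[of q n] pmf_best_response_path(1)[of q "n + 1"]
      by simp
    \<comment> \<open>As for player 1, one index later: the only deviation that can gain is
      \<open>b + 1\<close>, punished at \<open>(b, b)\<close> and rewarded at
      \<open>(b + 1, b)\<close>.\<close>
    also have "\<dots> \<le> \<epsilon>"
    proof (cases "b' = b + 1")
      case True
      then show ?thesis
        using gain[of "2 * n + 1" b] by (simp add: u2 flip: diff_divide_distrib)
    next
      case False
      then have "?g b \<le> 0" "?g (b + 1) \<le> 0"
        using \<rho> c\<rho>[of b] by (auto simp: u2 divide_right_mono)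
      then show ?thesis by (rule loss)
    qed
    finally show ?thesis .
  qed
  show ?thesis
    unfolding eps_correlated_eq_def
    using supp\<pi> dev1 dev2 by (simp add: DIR_def)
qed

text \<open>Nobody is punished on the path, so the payoffs at index \<open>t\<close> add up to
  \<open>(1 + t) / max K c\<close>, and \<open>t\<close> is at most \<open>L\<close>.\<close>

lemma welfare_DIR_best_response_path_le:
  assumes c: "0 < c" and supp: "set_pmf q \<subseteq> {1..L}"
  shows "welfare (DIR K c) (map_pmf best_response_path q) \<le> (1 + real L) / max (real K) c"
proof -
  let ?u = "\<lambda>(a, b). payoff1 (DIR K c) a b + payoff2 (DIR K c) a b"
  have \<rho>: "max (real K) c > 0" using c by simp
  have path: "?u (best_response_path t) = (1 + real t) / max (real K) c" for t
  proof -
    have "real (t div 2) + real ((t + 1) div 2) = real t"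
      unfolding of_nat_add[symmetric] of_nat_eq_iff by presburger
    moreover have "(t + 1) div 2 \<le> t div 2 + 1" "t div 2 + 1 \<le> (t + 1) div 2 + 1" by presburger+
    ultimately show ?thesis
      by (simp add: best_response_path_def DIR_def flip: add_divide_distrib)
  qed
  have "welfare (DIR K c) (map_pmf best_response_path q) =
      measure_pmf.expectation q (\<lambda>t. (1 + real t) / max (real K) c)"
    unfolding welfare_def integral_map_pmf path ..
  also have "\<dots> \<le> (1 + real L) / max (real K) c"
  proof (rule measure_pmf.integral_le_const)
    show "integrable (measure_pmf q) (\<lambda>t. (1 + real t) / max (real K) c)"
      using supp finite_subset by (intro integrable_measure_pmf_finite) blast
    show "AE t in measure_pmf q. (1 + real t) / max (real K) c \<le> (1 + real L) / max (real K) c"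
      using supp \<rho> by (auto simp: AE_measure_pmf_iff intro!: divide_right_mono)
  qed
  finally show ?thesis .
qed

text \<open>Normalise \<open>c ^ t\<close> on \<open>{1..L}\<close>. The normalising sum is at least
  its last term \<open>c ^ L\<close>, which bounds the first weight; at \<open>t = L\<close> the
  growth bound holds because the next weight is 0.\<close>

lemma geometric_pmf_exists:
  fixes c :: real
  assumes "0 < c" "1 \<le> L"
  obtains q :: "nat pmf" where "set_pmf q \<subseteq> {1..L}"
    "\<And>t. 1 \<le> t \<Longrightarrow> pmf q (t + 1) \<le> c * pmf q t" "pmf q 1 \<le> c / c ^ L"
proof -
  define S where "S = (\<Sum>t\<in>{1..L}. c ^ t)"
  define w where "w t = (if t \<in> {1..L} then c ^ t / S else 0)" for t
  have S_ge: "c ^ L \<le> S"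
    unfolding S_def using assms by (intro member_le_sum) auto
  have cL: "0 < c ^ L" using assms by simp
  have S: "0 < S" using S_ge cL by linarith
  have w_nonneg: "0 \<le> w t" for t using S assms by (simp add: w_def)
  have "(\<integral>\<^sup>+t. ennreal (w t) \<partial>count_space UNIV) = (\<Sum>t\<in>{1..L}. ennreal (w t))"
    by (rule nn_integral_count_space') (auto simp: w_def)
  also have "\<dots> = ennreal (\<Sum>t\<in>{1..L}. w t)"
    by (rule sum_ennreal) (rule w_nonneg)
  also have "(\<Sum>t\<in>{1..L}. w t) = (\<Sum>t\<in>{1..L}. c ^ t) / S"
    unfolding sum_divide_distrib by (rule sum.cong) (auto simp: w_def)
  also have "\<dots> = 1" using S by (simp add: S_def)
  finally have total: "(\<integral>\<^sup>+t. ennreal (w t) \<partial>count_space UNIV) = 1" by simp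
  have pmf_w: "pmf (embed_pmf w) t = w t" for t
    by (rule pmf_embed_pmf[OF w_nonneg total])
  show ?thesis
  proof
    show "set_pmf (embed_pmf w) \<subseteq> {1..L}"
      by (auto simp: set_pmf_iff pmf_w w_def split: if_splits)
    show "pmf (embed_pmf w) (t + 1) \<le> c * pmf (embed_pmf w) t" if "1 \<le> t" for t
      using that S assms by (simp add: pmf_w w_def)
    have "c / S \<le> c / c ^ L"
      by (rule divide_left_mono[OF S_ge]) (use S cL assms in simp_all)
    then show "pmf (embed_pmf w) 1 \<le> c / c ^ L"
      using assms by (simp add: pmf_w w_def)
  qed
qed

theorem theorem9:
  fixes K :: nat and c \<epsilon> :: real
  assumes "0 < \<epsilon>" and "\<epsilon> < 1"
    and "1 \<le> K" and "0 < c"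
    and "ln (1 / \<epsilon>) \<le> (2 * real K - 2) * ln c"
  shows "(\<forall>\<sigma>. correlated_eq (DIR K c) \<sigma> \<longleftrightarrow> \<sigma> = return_pmf (K, K)) \<and>
    (\<exists>\<pi>. eps_correlated_eq (DIR K c) \<epsilon> \<pi> \<and>
         pmf \<pi> (K, K) = 0 \<and>
         welfare (DIR K c) \<pi> \<le>
           (1 + real_of_int \<lceil>ln (1 / \<epsilon>) / ln c\<rceil>) / (2 * real K) *
           (payoff1 (DIR K c) K K + payoff2 (DIR K c) K K))"
proof -
  have ln\<epsilon>: "0 < ln (1 / \<epsilon>)" using assms(1,2) by simp
  \<comment> \<open>The hypotheses thus force \<open>K\<close> to be at least 2 and
    \<open>c > 1\<close>.\<close>
  then have "0 < (2 * real K - 2) * ln c" using assms(5) by linarith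
  then have K: "2 \<le> K" and lnc: "0 < ln c"
    using assms(3) by (auto simp: zero_less_mult_iff)
  define L where "L = nat \<lceil>ln (1 / \<epsilon>) / ln c\<rceil>"
  have ratio: "0 < ln (1 / \<epsilon>) / ln c" using ln\<epsilon> lnc by simp
  then have L_int: "int L = \<lceil>ln (1 / \<epsilon>) / ln c\<rceil>" by (simp add: L_def)
  have L1: "1 \<le> L" using ratio L_int by linarith
  \<comment> \<open>The bound is an integer, so it survives the ceiling: the path stops before
    \<open>(K, K)\<close>.\<close>
  have "ln (1 / \<epsilon>) / ln c \<le> real_of_int (2 * int K - 2)"
    using assms(5) lnc by (simp add: divide_le_eq)
  then have "\<lceil>ln (1 / \<epsilon>) / ln c\<rceil> \<le> 2 * int K - 2" by (rule ceiling_le)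
  then have LK: "L \<le> 2 * K - 2" using L_int K by linarith
  have "ln (1 / \<epsilon>) / ln c \<le> real L" by (simp add: L_def real_nat_ceiling_ge)
  then have "ln (1 / \<epsilon>) \<le> ln (c ^ L)"
    using lnc assms(4) by (simp add: divide_le_eq ln_realpow)
  then have cL: "1 / \<epsilon> \<le> c ^ L" using assms(1,4) by (subst (asm) ln_le_cancel_iff) auto
  obtain q where q: "set_pmf q \<subseteq> {1..L}" "\<And>t. 1 \<le> t \<Longrightarrow> pmf q (t + 1) \<le> c * pmf q t"
    "pmf q 1 \<le> c / c ^ L"
    using geometric_pmf_exists[OF assms(4) L1] by blast
  have "c / c ^ L \<le> \<epsilon> * c"
    using cL assms(1,4) by (simp add: field_simps)
  also have "\<dots> \<le> \<epsilon> * max (real K) c" using assms(1) by simp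
  finally have first: "pmf q 1 \<le> \<epsilon> * max (real K) c" using q(3) by linarith
  have supp: "set_pmf q \<subseteq> {1..2 * K - 2}" using q(1) LK by force
  have "(K, K) \<notin> set_pmf (map_pmf best_response_path q)"
    using supp by (fastforce simp: best_response_path_def)
  then have zero: "pmf (map_pmf best_response_path q) (K, K) = 0"
    by (rule pmf_eq_0_set_pmf[THEN iffD2])
  \<comment> \<open>The profile \<open>(K, K)\<close> has welfare \<open>2 * K / max K c\<close>, so
    the factor \<open>2 * K\<close> cancels.\<close>
  have "(1 + real L) / max (real K) c =
      (1 + real_of_int \<lceil>ln (1 / \<epsilon>) / ln c\<rceil>) / (2 * real K) *
      (payoff1 (DIR K c) K K + payoff2 (DIR K c) K K)"
    using K by (simp add: DIR_def flip: L_int)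
  then have "welfare (DIR K c) (map_pmf best_response_path q) \<le> \<dots>"
    using welfare_DIR_best_response_path_le[OF assms(4) q(1)] by metis
  then show ?thesis
    using correlated_eq_DIR_iff[OF assms(3,4)] zero
      eps_correlated_eq_DIR_best_response_path[OF assms(4) _ supp first q(2)] assms(1)
    by (metis less_imp_le)
qed

end
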